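(* Let $\phi:\mathbb{Q}[\alpha_1,\alpha_2]\to\mathbb{Q}$ be a circular integral functional with respect to the circle $C=\{[x,y]\in\mathbb{Q}^2: x^2+y^2=4\}$ (of radius $2$ centered at $[0,0]$). Then for all $m,n\in\mathbb{N}$, \[ \phi(\alpha_1^{2m}\alpha_2^{2n})=2S(m,n),\qquad\text{where } S(m,n)=\frac{(2m)!(2n)!}{m!\,n!\,(m+n)!}. \]
   Context: $\mathbb{N}$ includes $0$. $SO(2,\mathbb{Q})$ is the group of $2\times2$ rational matrices $h$ with $h^{-1}=h^T$ and $\det h=1$, acting on $\mathbb{Q}[\alpha_1,\alpha_2]$ by $h\cdot\pi(\alpha_1,\alpha_2)=\pi(h_{11}\alpha_1+h_{21}\alpha_2,\,h_{12}\alpha_1+h_{22}\alpha_2)$. A circular integral functional with respect to the circle $C$ of radius $r=2$ centered at $[0,0]$ is a $\mathbb{Q}$-linear map $\phi$ with (Normalization) $\phi(\mathbf{1})=r=2$ for the constant polynomial $\mathbf{1}$; (Locality) $\phi(\pi)=0$ whenever $\pi(x,y)=0$ for all $[x,y]\in C$; (Invariance) $\phi(h\cdot\pi)=\phi(\pi)$ for all $\pi$ and all $h\in SO(2,\mathbb{Q})$. *)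

theory Defs
  imports "HOL-Analysis.Analysis" "HOL-Computational_Algebra.Polynomial"
begin

(* Q[alpha_1, alpha_2] is represented as Q[alpha_1][alpha_2]: the inner variable is alpha_1,
   the outer variable is alpha_2. *)

type_synonym bipoly = "rat poly poly"

definition \<alpha>\<^sub>1 :: bipoly where
  "\<alpha>\<^sub>1 = [:[:0, 1:]:]"

definition \<alpha>\<^sub>2 :: bipoly where
  "\<alpha>\<^sub>2 = [:0, 1:]"

definition bipoly_eval :: "bipoly \<Rightarrow> rat \<Rightarrow> rat \<Rightarrow> rat" where
  "bipoly_eval \<pi> x y = poly (poly \<pi> [:y:]) x"

(* bipoly_subst \<pi> P Q is \<pi>(P, Q): the coefficients of \<pi>, which are polynomials in alpha_1,
   are evaluated at P, and the resulting polynomial in alpha_2 is evaluated at Q. *)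
definition bipoly_subst :: "bipoly \<Rightarrow> bipoly \<Rightarrow> bipoly \<Rightarrow> bipoly" where
  "bipoly_subst \<pi> P Q = poly (map_poly (\<lambda>c. poly (map_poly (\<lambda>a. [:[:a:]:]) c) P) \<pi>) Q"

definition scale :: "rat \<Rightarrow> bipoly \<Rightarrow> bipoly" where
  "scale c = smult [:c:]"

definition SO2 :: "(rat^2^2) set" where
  "SO2 = {h. orthogonal_matrix h \<and> det h = 1}"

definition matrix_act :: "rat^2^2 \<Rightarrow> bipoly \<Rightarrow> bipoly" where
  "matrix_act h \<pi> = bipoly_subst \<pi>
     (scale (h$1$1) \<alpha>\<^sub>1 + scale (h$2$1) \<alpha>\<^sub>2)
     (scale (h$1$2) \<alpha>\<^sub>1 + scale (h$2$2) \<alpha>\<^sub>2)"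

definition circle :: "rat \<Rightarrow> (rat \<times> rat) set" where
  "circle r = {(x, y). x\<^sup>2 + y\<^sup>2 = r\<^sup>2}"

definition circular_integral_functional :: "rat \<Rightarrow> (bipoly \<Rightarrow> rat) \<Rightarrow> bool" where
  "circular_integral_functional r \<phi> \<longleftrightarrow>
     Vector_Spaces.linear scale (*) \<phi> \<and>
     \<phi> 1 = r \<and>
     (\<forall>\<pi>. (\<forall>(x, y)\<in>circle r. bipoly_eval \<pi> x y = 0) \<longrightarrow> \<phi> \<pi> = 0) \<and>
     (\<forall>\<pi>. \<forall>h\<in>SO2. \<phi> (matrix_act h \<pi>) = \<phi> \<pi>)"

definition super_catalan :: "nat \<Rightarrow> nat \<Rightarrow> rat" where
  "super_catalan m n = fact (2 * m) * fact (2 * n) / (fact m * fact n * fact (m + n))"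

end

theory Submission
  imports Defs
begin

text \<open>
  Rotating a monomial by the rational rotation with parameter \<open>t\<close> (cosine
  \<open>(1 - t\<^sup>2)/(1 + t\<^sup>2)\<close>, sine \<open>2t/(1 + t\<^sup>2)\<close>) and clearing denominators yields a polynomial in
  \<open>t\<close>. Invariance holds for all rational \<open>t\<close>, hence as an identity of polynomials in \<open>t\<close>, and its
  linear coefficient says that the functional annihilates
  \<open>(y \<partial>\<^sub>x - x \<partial>\<^sub>y) (x\<^sup>p y\<^sup>q)\<close>. Together with locality applied to \<open>x\<^sup>2 + y\<^sup>2 - 4\<close>, this
  gives a recurrence that determines the even moments.
\<close>

text \<open>The usual matrix with rows (c, -s) and (s, c). Since \<open>matrix_act\<close> reads
  columns, it sends \<open>\<alpha>\<^sub>1\<close> to c \<open>\<alpha>\<^sub>1\<close> + s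
  \<open>\<alpha>\<^sub>2\<close> and \<open>\<alpha>\<^sub>2\<close> to -s
  \<open>\<alpha>\<^sub>1\<close> + c \<open>\<alpha>\<^sub>2\<close>.\<close>

definition rational_rotation :: "rat \<Rightarrow> rat^2^2" where
  "rational_rotation t = (\<chi> i j. if i = j then (1 - t\<^sup>2) / (1 + t\<^sup>2)
     else if i = 1 then - 2 * t / (1 + t\<^sup>2) else 2 * t / (1 + t\<^sup>2))"

lemma one_plus_square_neq_0: "1 + t\<^sup>2 \<noteq> (0::rat)"
  using zero_le_power2[of t] by linarith

lemma rational_rotation_in_SO2: "rational_rotation t \<in> SO2"
proof -
  define c s where "c = (1 - t\<^sup>2) / (1 + t\<^sup>2)" and "s = 2 * t / (1 + t\<^sup>2)"
  have "c * c + s * s = ((1 - t\<^sup>2)\<^sup>2 + (2 * t)\<^sup>2) / (1 + t\<^sup>2)\<^sup>2"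
    by (simp add: c_def s_def power2_eq_square add_divide_distrib)
  also have "(1 - t\<^sup>2)\<^sup>2 + (2 * t)\<^sup>2 = (1 + t\<^sup>2)\<^sup>2"
    by (simp add: power2_eq_square algebra_simps)
  finally have cs: "c * c + s * s = 1"
    using one_plus_square_neq_0[of t] by simp
  have h: "rational_rotation t = (\<chi> i j. if i = j then c else if i = 1 then - s else s)"
    by (simp add: rational_rotation_def c_def s_def vec_eq_iff)
  show ?thesis
    unfolding SO2_def h
    using cs
    by (simp add: orthogonal_matrix_def matrix_matrix_mult_def transpose_def mat_def
        vec_eq_iff forall_2 sum_2 det_2 add.commute)
qed

lemma scale_eq_mult: "scale c \<pi> = [:[:c:]:] * \<pi>"
  by (simp add: scale_def)

lemma const_power: "[:[:c:]:] ^ n = [:[:c ^ n:]:]" for c :: "'a::comm_ring_1"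
  by (induction n) (simp_all add: one_pCons)

text \<open>Puts monomials in the form on which the nested \<open>map_poly\<close> of
  \<open>bipoly_subst\<close> can be computed directly.\<close>

lemma monomial_eq_monom: "\<alpha>\<^sub>1 ^ p * \<alpha>\<^sub>2 ^ q = monom (monom 1 p) q"
proof -
  have 1: "\<alpha>\<^sub>1 ^ p = monom (monom 1 p) 0"
    by (induction p) (simp_all add: \<alpha>\<^sub>1_def monom_0 monom_Suc one_pCons)
  have 2: "\<alpha>\<^sub>2 ^ q = monom 1 q"
    by (simp add: \<alpha>\<^sub>2_def monom_altdef)
  show ?thesis
    by (simp add: 1 2 mult_monom)
qed

lemma bipoly_subst_monomial: "bipoly_subst (\<alpha>\<^sub>1 ^ p * \<alpha>\<^sub>2 ^ q) P Q = P ^ p * Q ^ q"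
  by (simp add: monomial_eq_monom bipoly_subst_def map_poly_monom poly_monom
      flip: one_pCons)

text \<open>Here \<open>F\<close> is a polynomial in the parameter \<open>t\<close> with bivariate
  coefficients. Multiplying by the constant \<open>[:[:t:]:]\<close> is scaling by \<open>t\<close>,
  so linearity lets \<open>\<phi>\<close> pass to each coefficient.\<close>

lemma poly_map_poly_functional:
  assumes "Vector_Spaces.linear scale (*) \<phi>"
  shows "poly (map_poly \<phi> F) t = \<phi> (poly F [:[:t:]:])"
proof -
  interpret \<phi>: Vector_Spaces.linear scale "(*)" \<phi> by fact
  show ?thesis
  proof (induction F)
    case 0
    then show ?case by (simp add: \<phi>.zero)
  next
    case (pCons a F)
    then show ?case
      using \<phi>.scale[of t]
      by (simp add: map_poly_pCons \<phi>.zero \<phi>.add scale_def)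
  qed
qed

lemma circular_integral_functionalD:
  assumes "circular_integral_functional r \<phi>"
  shows linear_circular: "Vector_Spaces.linear scale (*) \<phi>"
    and circular_1: "\<phi> 1 = r"
    and locality: "\<forall>(x, y)\<in>circle r. bipoly_eval \<pi> x y = 0 \<Longrightarrow> \<phi> \<pi> = 0"
    and invariance: "h \<in> SO2 \<Longrightarrow> \<phi> (matrix_act h \<pi>) = \<phi> \<pi>"
  using assms unfolding circular_integral_functional_def by blast+

text \<open>The two sides are the two terms of the infinitesimal rotation of the monomial. When
  \<open>p\<close> or \<open>q\<close> is 0, the truncated exponent is harmless because its factor
  vanishes.\<close>

lemma rotation_derivative_eq_0:
  assumes \<phi>: "circular_integral_functional r \<phi>"
  shows "of_nat p * \<phi> (\<alpha>\<^sub>1 ^ (p - 1) * \<alpha>\<^sub>2 ^ (q + 1)) = of_nat q * \<phi> (\<alpha>\<^sub>1 ^ (p + 1) * \<alpha>\<^sub>2 ^ (q - 1))"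
proof -
  interpret \<phi>: Vector_Spaces.linear scale "(*)" \<phi> by (fact linear_circular[OF \<phi>])
  \<comment> \<open>The bases, as polynomials in \<open>t\<close>, are \<open>1 + t\<^sup>2\<close>
    times the images of \<open>\<alpha>\<^sub>1\<close> and \<open>\<alpha>\<^sub>2\<close> under
    the rotation.\<close>
  define F where "F = [:\<alpha>\<^sub>1, 2 * \<alpha>\<^sub>2, - \<alpha>\<^sub>1:] ^ p * [:\<alpha>\<^sub>2, - 2 * \<alpha>\<^sub>1, - \<alpha>\<^sub>2:] ^ q"
  define v where "v = \<phi> (\<alpha>\<^sub>1 ^ p * \<alpha>\<^sub>2 ^ q)"
  have two: "(2::bipoly) = [:[:2:]:]"
    by (simp add: numeral_poly)
  have F: "poly F [:[:t:]:] = scale ((1 + t\<^sup>2) ^ (p + q)) (matrix_act (rational_rotation t) (\<alpha>\<^sub>1 ^ p * \<alpha>\<^sub>2 ^ q))"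
    for t
  proof -
    let ?h = "rational_rotation t" and ?d = "[:[:1 + t\<^sup>2:]:] :: bipoly"
    define c s where "c = (1 - t\<^sup>2) / (1 + t\<^sup>2)" and "s = 2 * t / (1 + t\<^sup>2)"
    have h: "?h$1$1 = c" "?h$2$1 = s" "?h$1$2 = - s" "?h$2$2 = c"
      by (simp_all add: rational_rotation_def c_def s_def)
    have d: "(1 + t\<^sup>2) * c = 1 - t\<^sup>2" "(1 + t\<^sup>2) * s = 2 * t"
      using one_plus_square_neq_0[of t] by (simp_all add: c_def s_def)
    have rot: "?d * (scale a \<alpha>\<^sub>1 + scale b \<alpha>\<^sub>2) = [:[:0, (1 + t\<^sup>2) * a:], [:(1 + t\<^sup>2) * b:]:]"
      for a b
      by (simp add: scale_def \<alpha>\<^sub>1_def \<alpha>\<^sub>2_def)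
    have X: "poly [:\<alpha>\<^sub>1, 2 * \<alpha>\<^sub>2, - \<alpha>\<^sub>1:] [:[:t:]:] = ?d * (scale (?h$1$1) \<alpha>\<^sub>1 + scale (?h$2$1) \<alpha>\<^sub>2)"
      unfolding h rot mult_minus_right d
      by (simp add: two \<alpha>\<^sub>1_def \<alpha>\<^sub>2_def power2_eq_square one_pCons)
    have Y: "poly [:\<alpha>\<^sub>2, - 2 * \<alpha>\<^sub>1, - \<alpha>\<^sub>2:] [:[:t:]:] = ?d * (scale (?h$1$2) \<alpha>\<^sub>1 + scale (?h$2$2) \<alpha>\<^sub>2)"
      unfolding h rot mult_minus_right d
      by (simp add: two \<alpha>\<^sub>1_def \<alpha>\<^sub>2_def power2_eq_square one_pCons)
    have "[:[:(1 + t\<^sup>2) ^ (p + q):]:] = ?d ^ p * ?d ^ q"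
      by (simp only: flip: const_power power_add)
    then show ?thesis
      unfolding F_def poly_mult poly_power X Y matrix_act_def bipoly_subst_monomial scale_eq_mult
        power_mult_distrib
      by (simp only: mult_ac)
  qed
  \<comment> \<open>By invariance both sides agree at every rational \<open>t\<close>. As the field
    is infinite, the polynomials themselves are equal.\<close>
  have "poly (map_poly \<phi> F) = poly ([:v:] * [:1, 0, 1:] ^ (p + q))"
  proof
    fix t
    have "poly (map_poly \<phi> F) t = (1 + t\<^sup>2) ^ (p + q) * v"
      unfolding poly_map_poly_functional[OF linear_circular[OF \<phi>]] F \<phi>.scale v_def
        invariance[OF \<phi> rational_rotation_in_SO2] ..
    then show "poly (map_poly \<phi> F) t = poly ([:v:] * [:1, 0, 1:] ^ (p + q)) t"
      by (simp add: poly_power power2_eq_square)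
  qed
  then have eq: "map_poly \<phi> F = [:v:] * [:1, 0, 1:] ^ (p + q)"
    by (simp only: poly_eq_poly_eq_iff)
  \<comment> \<open>Reading the linear coefficient as a derivative at 0 makes the product and power
    rules available for both sides.\<close>
  have coeff_1: "coeff G 1 = poly (pderiv G) 0" for G :: "'a::idom poly"
    by (simp add: poly_0_coeff_0 coeff_pderiv)
  have "\<phi> (coeff F 1) = coeff (map_poly \<phi> F) 1"
    by (simp add: coeff_map_poly \<phi>.zero)
  \<comment> \<open>The right side is a polynomial in \<open>t\<^sup>2\<close>, so it has no linear
    term.\<close>
  also have "\<dots> = 0"
    unfolding eq coeff_1 by (simp add: pderiv_mult pderiv_power pderiv_pCons pderiv_smult)
  also have "coeff F 1 = scale (2 * of_nat p) (\<alpha>\<^sub>1 ^ (p - 1) * \<alpha>\<^sub>2 ^ (q + 1))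
      - scale (2 * of_nat q) (\<alpha>\<^sub>1 ^ (p + 1) * \<alpha>\<^sub>2 ^ (q - 1))"
  proof -
    have of_nat_const: "(of_nat k :: bipoly) = [:[:of_nat k:]:]" for k
      by (simp add: of_nat_poly)
    have "[:[:2 * of_nat k:]:] = 2 * (of_nat k :: bipoly)" for k
      by (simp add: two of_nat_const)
    then show ?thesis
      unfolding coeff_1 scale_eq_mult
      by (simp add: F_def pderiv_mult pderiv_power pderiv_pCons poly_power algebra_simps)
  qed
  finally show ?thesis
    by (simp add: \<phi>.diff \<phi>.scale)
qed

text \<open>Locality applied to the monomial times \<open>x\<^sup>2 + y\<^sup>2 - r\<^sup>2\<close>,
  which vanishes on the circle.\<close>

lemma circle_relation:
  assumes \<phi>: "circular_integral_functional r \<phi>"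
  shows "\<phi> (\<alpha>\<^sub>1 ^ (p + 2) * \<alpha>\<^sub>2 ^ q) + \<phi> (\<alpha>\<^sub>1 ^ p * \<alpha>\<^sub>2 ^ (q + 2)) = r\<^sup>2 * \<phi> (\<alpha>\<^sub>1 ^ p * \<alpha>\<^sub>2 ^ q)"
proof -
  interpret \<phi>: Vector_Spaces.linear scale "(*)" \<phi> by (fact linear_circular[OF \<phi>])
  have "\<phi> (\<alpha>\<^sub>1 ^ (p + 2) * \<alpha>\<^sub>2 ^ q + \<alpha>\<^sub>1 ^ p * \<alpha>\<^sub>2 ^ (q + 2) - scale (r\<^sup>2) (\<alpha>\<^sub>1 ^ p * \<alpha>\<^sub>2 ^ q)) = 0"
  proof (rule locality[OF \<phi>], clarify)
    fix x y
    assume "(x, y) \<in> circle r"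
    then have "r\<^sup>2 = x\<^sup>2 + y\<^sup>2"
      by (simp add: circle_def)
    then show "bipoly_eval (\<alpha>\<^sub>1 ^ (p + 2) * \<alpha>\<^sub>2 ^ q + \<alpha>\<^sub>1 ^ p * \<alpha>\<^sub>2 ^ (q + 2)
        - scale (r\<^sup>2) (\<alpha>\<^sub>1 ^ p * \<alpha>\<^sub>2 ^ q)) x y = 0"
      by (simp add: bipoly_eval_def scale_def \<alpha>\<^sub>1_def \<alpha>\<^sub>2_def algebra_simps
          power2_eq_square)
  qed
  then show ?thesis
    by (simp add: \<phi>.add \<phi>.diff \<phi>.scale)
qed

text \<open>This is the recurrence that the even moments will be shown to satisfy, so it drives the
  comparison by induction.\<close>

lemma super_catalan_Suc_left:
  "(of_nat m + of_nat n + 1) * super_catalan (Suc m) n = 2 * (2 * of_nat m + 1) * super_catalan m n"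
proof -
  have "fact (2 * Suc m) = (2 * of_nat m + 2) * (2 * of_nat m + 1) * (fact (2 * m) :: rat)"
    by (simp add: algebra_simps)
  moreover have "fact (Suc m + n) = (of_nat m + of_nat n + 1) * (fact (m + n) :: rat)"
    by (simp add: algebra_simps)
  moreover have "fact (Suc m) = (of_nat m + 1) * (fact m :: rat)"
    by (simp add: algebra_simps)
  moreover have "of_nat m + of_nat n + 1 \<noteq> (0::rat)" "of_nat m + 1 \<noteq> (0::rat)"
    by (metis of_nat_add of_nat_Suc of_nat_neq_0 add.commute)+
  ultimately show ?thesis
    unfolding super_catalan_def by (simp add: divide_simps) (simp add: algebra_simps)
qed

lemma super_catalan_commute: "super_catalan m n = super_catalan n m"
  by (simp add: super_catalan_def ac_simps)

theorem theorem15: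
  fixes \<phi> :: "bipoly \<Rightarrow> rat" and m n :: nat
  assumes "circular_integral_functional 2 \<phi>"
  shows "\<phi> (\<alpha>\<^sub>1 ^ (2 * m) * \<alpha>\<^sub>2 ^ (2 * n)) = 2 * super_catalan m n"
proof -
  define f where "f m n = \<phi> (\<alpha>\<^sub>1 ^ (2 * m) * \<alpha>\<^sub>2 ^ (2 * n))" for m n
  have circ: "f (Suc m) n + f m (Suc n) = 4 * f m n" for m n
    using circle_relation[OF assms, of "2 * m" "2 * n"] by (simp add: f_def)
  \<comment> \<open>Odd exponents are rotated because the derivative shifts each of them by one,
    leaving only even moments.\<close>
  have rot: "(2 * of_nat m + 1) * f m (Suc n) = (2 * of_nat n + 1) * f (Suc m) n" for m n
    using rotation_derivative_eq_0[OF assms, of "2 * m + 1" "2 * n + 1"]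
    by (simp add: f_def add.commute)
  have pos: "of_nat m + of_nat n + 1 \<noteq> (0::rat)" for m n
    by (metis of_nat_add of_nat_Suc of_nat_neq_0 add.commute)
  \<comment> \<open>Multiply \<open>circ\<close> by \<open>2 * m + 1\<close>, replace
    \<open>f m (Suc n)\<close> by means of \<open>rot\<close>, and halve; \<open>right\<close> is
    symmetric.\<close>
  have left: "(of_nat m + of_nat n + 1) * f (Suc m) n = 2 * (2 * of_nat m + 1) * f m n" for m n
    using circ[of m n] rot[of m n] by algebra
  have right: "(of_nat m + of_nat n + 1) * f m (Suc n) = 2 * (2 * of_nat n + 1) * f m n" for m n
    using circ[of m n] rot[of m n] by algebra
  have "f m n = 2 * super_catalan m n" for m n
  \<comment> \<open>\<open>left\<close> raises \<open>m\<close> for fixed \<open>n\<close>. The base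
    case \<open>m = 0\<close> is itself an induction on \<open>n\<close> by \<open>right\<close>,
    starting from the normalization \<open>\<phi> 1 = 2\<close>.\<close>
  proof (induction m)
    case 0
    show ?case
    proof (induction n)
      case 0
      then show ?case
        using circular_1[OF assms] by (simp add: f_def super_catalan_def)
    next
      case (Suc n)
      \<comment> \<open>The recurrence for the first index serves the second one by symmetry; the
        summand \<open>of_nat 0\<close> keeps the factor in the shape of \<open>pos\<close>, so that
        it can be cancelled.\<close>
      have "(of_nat n + of_nat 0 + 1) * f 0 (Suc n)
          = (of_nat n + of_nat 0 + 1) * (2 * super_catalan 0 (Suc n))"
        using right[of 0 n] super_catalan_Suc_left[of n 0] Suc
        by (simp add: super_catalan_commute[of 0])
      then show ?case
        using pos[of n 0] by (simp only: mult_cancel_left) simp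
    qed
  next
    case (Suc m)
    have "(of_nat m + of_nat n + 1) * f (Suc m) n
        = (of_nat m + of_nat n + 1) * (2 * super_catalan (Suc m) n)"
      using left[of m n] super_catalan_Suc_left[of m n] Suc by simp
    then show ?case
      using pos[of m n] by (simp only: mult_cancel_left) simp
  qed
  then show ?thesis
    by (simp add: f_def)
qed

end
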